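(* Let $\langle(p^{(t)},\Omega_t)\mid t\in\mathbb{N}^0\rangle$ be a linear dynamic optimization (LDO) problem on $X=[0,b]$, $b>0$. Then $\mathcal{S}(x)\neq\emptyset$ for all $x\in X$; that is, for every $x\in X$ the problem of maximizing $\sum_{t=0}^\infty p^{(t)}x_t$ over $\langle x_t\mid t\in\mathbb{N}^0\rangle\in\mathcal{F}(x)$ has a solution.
   Context: $\mathbb{N}^0=\{0,1,2,\dots\}$. An LDO problem $\langle(p^{(t)},\Omega_t)\mid t\in\mathbb{N}^0\rangle$ on $X=[0,b]$ consists of a sequence of real numbers $p^{(t)}$ with $\sum_{t=0}^\infty|p^{(t)}|<+\infty$ and sets $\Omega_t\subset X\times X$ such that for every $t\in\mathbb{N}^0$: (i) $\Omega_t$ is non-empty, closed and convex; (ii) for every $x\in X$ there is $y\in X$ with $(x,y)\in\Omega_t$. For $x\in X$, $\mathcal{F}(x)$ is the set of sequences $\langle x_t\mid t\in\mathbb{N}^0\rangle$ in $X$ with $x_0=x$ and $(x_t,x_{t+1})\in\Omega_t$ for all $t\in\mathbb{N}^0$; $\mathcal{S}(x)$ is the set of $\langle x_t\rangle\in\mathcal{F}(x)$ with $\sum_{t=0}^\infty p^{(t)}x_t\ge\sum_{t=0}^\infty p^{(t)}y_t$ for all $\langle y_t\rangle\in\mathcal{F}(x)$. *)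

theory Defs
  imports "HOL-Analysis.Analysis"
begin

definition LDO_problem :: "real \<Rightarrow> (nat \<Rightarrow> real) \<Rightarrow> (nat \<Rightarrow> (real \<times> real) set) \<Rightarrow> bool" where
  "LDO_problem b p \<Omega> \<longleftrightarrow>
     summable (\<lambda>t. \<bar>p t\<bar>) \<and>
     (\<forall>t. \<Omega> t \<subseteq> {0..b} \<times> {0..b} \<and>
          \<Omega> t \<noteq> {} \<and> closed (\<Omega> t) \<and> convex (\<Omega> t) \<and>
          (\<forall>x\<in>{0..b}. \<exists>y\<in>{0..b}. (x, y) \<in> \<Omega> t))"

definition feasible_seqs ::
    "real \<Rightarrow> (nat \<Rightarrow> (real \<times> real) set) \<Rightarrow> real \<Rightarrow> (nat \<Rightarrow> real) set" where
  "feasible_seqs b \<Omega> x =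
     {xs. (\<forall>t. xs t \<in> {0..b}) \<and> xs 0 = x \<and> (\<forall>t. (xs t, xs (Suc t)) \<in> \<Omega> t)}"

(* For an LDO problem, p is absolutely summable and feasible sequences are bounded, so the
   series below converge and suminf denotes their actual sums. *)
definition optimal_seqs ::
    "real \<Rightarrow> (nat \<Rightarrow> real) \<Rightarrow> (nat \<Rightarrow> (real \<times> real) set) \<Rightarrow> real \<Rightarrow> (nat \<Rightarrow> real) set" where
  "optimal_seqs b p \<Omega> x =
     {xs \<in> feasible_seqs b \<Omega> x.
        \<forall>ys \<in> feasible_seqs b \<Omega> x. (\<Sum>t. p t * xs t) \<ge> (\<Sum>t. p t * ys t)}"

end

theory Submission
  imports Defs
begin

text \<open>Feasibility is a conjunction of closed conditions, each on at most two coordinates, so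
  it cuts a closed subset out of the compact cube [0,b]^N (\<open>compact_feasible_seqs\<close>).
  The tails of the objective are small uniformly on the cube, since \<open>p\<close> is absolutely
  summable (\<open>continuous_on_weighted_suminf\<close>). Condition (ii) lets a path be continued
  forever (\<open>feasible_seqs_nonempty\<close>), and the extreme value theorem applies.\<close>

text \<open>In the product topology on sequences, Tychonoff makes the feasible set compact, and by the
  Weierstrass M-test the objective is continuous on it, so the maximum is attained.\<close>

lemma compact_funcs_UNIV:
  fixes A :: "'i \<Rightarrow> 'a::topological_space set"
  assumes "\<And>i. compact (A i)"
  shows "compact {f. \<forall>i. f i \<in> A i}"
proof -
  \<comment> \<open>\<open>compactin_PiE\<close> is Tychonoff for abstract topologies; the type
    class topology on functions is this product topology, so the result transfers.\<close>
  have "compactin (product_topology (\<lambda>_. euclidean) UNIV) (PiE UNIV A)"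
    using assms by (simp add: compactin_PiE)
  moreover have "PiE UNIV A = {f. \<forall>i. f i \<in> A i}"
    by (auto simp: PiE_UNIV_domain Pi_iff)
  ultimately show ?thesis
    by (simp add: euclidean_product_topology flip: compactin_euclidean_iff)
qed

text \<open>Coordinate projections are continuous in the product topology, so each constraint is the
  preimage of a closed set.\<close>

lemma compact_feasible_seqs:
  assumes "\<And>t. closed (\<Omega> t)"
  shows "compact (feasible_seqs b \<Omega> x)"
proof -
  have "closed {xs. (xs t, xs (Suc t)) \<in> \<Omega> t}" for t
  proof -
    have "closed ((\<lambda>xs. (xs t, xs (Suc t))) -` \<Omega> t)"
      by (intro closed_vimage assms continuous_on_Pair continuous_on_product_coordinates)
    then show ?thesis
      by (simp add: vimage_def)
  qed
  moreover have "closed {xs :: nat \<Rightarrow> real. xs 0 = x}"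
    by (intro closed_Collect_eq continuous_on_product_coordinates continuous_on_const)
  ultimately have "closed ({xs. xs 0 = x} \<inter> (\<Inter>t. {xs. (xs t, xs (Suc t)) \<in> \<Omega> t}))"
    by blast
  then have "compact ({xs. \<forall>t. xs t \<in> {0..b}} \<inter>
      ({xs. xs 0 = x} \<inter> (\<Inter>t. {xs. (xs t, xs (Suc t)) \<in> \<Omega> t})))"
    by (intro compact_Int_closed compact_funcs_UNIV) auto
  also have "\<dots> = feasible_seqs b \<Omega> x"
    by (auto simp: feasible_seqs_def)
  finally show ?thesis .
qed

lemma feasible_seqs_nonempty:
  assumes "x \<in> {0..b}" and "\<And>t x. x \<in> {0..b} \<Longrightarrow> \<exists>y\<in>{0..b}. (x, y) \<in> \<Omega> t"
  shows "feasible_seqs b \<Omega> x \<noteq> {}"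
proof -
  define g where "g t x = (SOME y. y \<in> {0..b} \<and> (x, y) \<in> \<Omega> t)" for t x
  have g: "g t x \<in> {0..b} \<and> (x, g t x) \<in> \<Omega> t" if "x \<in> {0..b}" for t x
    unfolding g_def by (rule someI_ex) (use assms(2)[OF that] in blast)
  \<comment> \<open>The recursor passes the index first, so \<open>xs (Suc t) = g t (xs t)\<close>;
    as \<open>g t\<close> maps [0,b] into itself, the choice can always be repeated.\<close>
  define xs where "xs = rec_nat x g"
  have "xs t \<in> {0..b}" for t
    by (induction t) (use assms(1) g in \<open>auto simp: xs_def\<close>)
  moreover from this have "(xs t, xs (Suc t)) \<in> \<Omega> t" for t
    using g[of "xs t" t] by (simp add: xs_def)
  ultimately have "xs \<in> feasible_seqs b \<Omega> x"
    by (simp add: feasible_seqs_def xs_def)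
  then show ?thesis by blast
qed

text \<open>Partial sums depend on finitely many coordinates, hence are continuous; the bound
  \<open>\<bar>p t\<bar> * b\<close> does not depend on \<open>xs\<close>, so they converge
  uniformly on \<open>S\<close>.\<close>

lemma continuous_on_weighted_suminf:
  fixes p :: "nat \<Rightarrow> real" and S :: "(nat \<Rightarrow> real) set"
  assumes "summable (\<lambda>t. \<bar>p t\<bar>)" and "\<And>xs t. xs \<in> S \<Longrightarrow> \<bar>xs t\<bar> \<le> b"
  shows "continuous_on S (\<lambda>xs. \<Sum>t. p t * xs t)"
proof (rule uniform_limit_theorem)
  show "uniform_limit S (\<lambda>n xs. \<Sum>t<n. p t * xs t) (\<lambda>xs. \<Sum>t. p t * xs t) sequentially"
  proof (rule Weierstrass_m_test[where M = "\<lambda>t. \<bar>p t\<bar> * b"])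
    show "norm (p t * xs t) \<le> \<bar>p t\<bar> * b" if "xs \<in> S" for t xs
      using assms(2)[OF that] by (simp add: abs_mult mult_left_mono)
    show "summable (\<lambda>t. \<bar>p t\<bar> * b)"
      using assms(1) by (rule summable_mult2)
  qed
  show "\<forall>\<^sub>F n in sequentially. continuous_on S (\<lambda>xs. \<Sum>t<n. p t * xs t)"
    by (intro always_eventually allI continuous_on_sum continuous_on_mult continuous_on_const
        continuous_on_subset[OF continuous_on_product_coordinates] subset_UNIV)
qed simp

theorem proposition3p1:
  fixes b :: real and p :: "nat \<Rightarrow> real" and \<Omega> :: "nat \<Rightarrow> (real \<times> real) set"
  assumes "b > 0" and "LDO_problem b p \<Omega>"
  shows "\<forall>x\<in>{0..b}. optimal_seqs b p \<Omega> x \<noteq> {}"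
proof
  fix x assume x: "x \<in> {0..b}"
  \<comment> \<open>Feasible values lie in [0,b], so \<open>b\<close> itself is the uniform
    bound.\<close>
  have "continuous_on (feasible_seqs b \<Omega> x) (\<lambda>xs. \<Sum>t. p t * xs t)"
    using assms(2)
    by (intro continuous_on_weighted_suminf[where b = b]) (auto simp: LDO_problem_def feasible_seqs_def)
  moreover have "compact (feasible_seqs b \<Omega> x)"
    using assms(2) by (intro compact_feasible_seqs) (auto simp: LDO_problem_def)
  moreover have "feasible_seqs b \<Omega> x \<noteq> {}"
    using assms(2) x by (intro feasible_seqs_nonempty) (auto simp: LDO_problem_def)
  ultimately obtain xs where "xs \<in> feasible_seqs b \<Omega> x"
    "\<forall>ys\<in>feasible_seqs b \<Omega> x. (\<Sum>t. p t * ys t) \<le> (\<Sum>t. p t * xs t)"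
    using continuous_attains_sup by blast
  then show "optimal_seqs b p \<Omega> x \<noteq> {}"
    by (auto simp: optimal_seqs_def)
qed

end
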